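(* Let $r\ge 1$ be an integer, let $P:\mathbb R\to\mathbb R$ satisfy the initial assumptions (A1)--(A3) of the context, and let $\lambda:(\Gamma_P\backslash\Gamma)\times\mathbb R\to[0,\infty)$, where $\Gamma=PGL_2(\mathbb Z)$, satisfy the compatibility condition (C') and Properties (1'), (3') of the context. Then the function $$T(x)=\sum_{\overline\gamma\in\Gamma_P\backslash\Gamma}\lambda(\overline\gamma,x)\,\bigl(P_{\overline\gamma}\bigr)_+(x)$$ is well defined (the series of nonnegative terms converges for every $x\in\mathbb R$), even, $1$-periodic and continuous on $\mathbb R$, and it satisfies the reciprocal functional equation $$x^{2r}\,T\!\left(\frac1x\right)-T(x)=-R_\lambda(x),\qquad x\neq0,$$ where $$R_\lambda(x):=\sum_{\substack{\overline\gamma\in\Gamma_P\backslash\Gamma\\ P_{\overline\gamma}(0)>0}}\lambda(\overline\gamma,x)\,P_{\overline\gamma}(x).$$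
   Context: Initial assumptions on $P$ (for a fixed integer $r\ge1$): (A1) $P:\mathbb R\to\mathbb R$ is continuous and piecewise polynomial, with each polynomial piece of degree at most $2r$. (A2) $P$ has exactly two real roots $\alpha<\beta$, both irrational, with $P(x)>0$ for $x\in(\alpha,\beta)$ and $P(x)<0$ for $x\notin[\alpha,\beta]$. (A3) There exists $L<0$ such that $\lim_{x\to-\infty}P(x)/x^{2r}=\lim_{x\to+\infty}P(x)/x^{2r}=L$. Action. For $\gamma=\begin{pmatrix}a&b\\c&d\end{pmatrix}\in\Gamma=PGL_2(\mathbb Z)$ (acting by Möbius transformations $\gamma x=\frac{ax+b}{cx+d}$), put $P^\gamma(x)=(cx+d)^{2r}P\left(\frac{ax+b}{cx+d}\right)$, with the value at the pole $x=-d/c$ (if $c\ne0$) defined by continuity (the limit exists by (A3)). Write $P^\gamma(\infty)$ for $\lim_{x\to\pm\infty}P^\gamma(x)/x^{2r}$ (the "leading coefficient", nonzero because the roots of $P$ are irrational), and let $\varepsilon_\gamma=1$ if $P^\gamma(\infty)<0$ and $\varepsilon_\gamma=-1$ if $P^\gamma(\infty)>0$. Let $\Gamma_P=\{\gamma\in\Gamma:\varepsilon_\gamma P^\gamma\equiv P\}$, a subgroup of $\Gamma$. The function $\varepsilon_\gamma P^\gamma$ depends only on the coset $\overline\gamma=\Gamma_P\gamma\in\Gamma_P\backslash\Gamma$, and we set $P_{\overline\gamma}:=\varepsilon_\gamma P^\gamma$. For a real-valued function $Q$, $Q_+(x):=\max\{Q(x),0\}$. Let $\mathsf T(x)=x+1$,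 $V(x)=-x$, $U(x)=1/x$, regarded as elements of $\Gamma$; $\Gamma$ acts on $\Gamma_P\backslash\Gamma$ by right multiplication. Conditions on the weights $\lambda(\overline\gamma,x)\ge0$: (C') For every $\sigma\in\{\mathsf T,V,U\}$ and $\overline\gamma\in\Gamma_P\backslash\Gamma$: $\lambda(\overline\gamma\sigma^{-1},\sigma x)=\lambda(\overline\gamma,x)$ for all $x$ with $x,\sigma x\in\mathbb R$. (1') For every $\overline\gamma\in\Gamma_P\backslash\Gamma$, the function $x\mapsto\lambda(\overline\gamma,x)P_{\overline\gamma}(x)$ is continuous on $\mathbb R$. (3') There are only finitely many cosets $\overline\gamma\in\Gamma_P\backslash\Gamma$ such that $P_{\overline\gamma}(0)>0$. *)

theory Defs
  imports "HOL-Analysis.Analysis" "HOL-Algebra.Coset" "HOL-Computational_Algebra.Polynomial"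
begin

section \<open>The group \<open>PGL\<^sub>2(\<int>)\<close>\<close>

definition GL2Z :: "(int^2^2) monoid" where
  "GL2Z = \<lparr>carrier = {A. invertible A}, mult = (**), one = mat 1\<rparr>"

definition PGL2Z :: "(int^2^2) set monoid" where
  "PGL2Z = GL2Z Mod {mat 1, - mat 1}"

text \<open>The class \<open>{A, -A}\<close> of a matrix.\<close>

definition pgl :: "int^2^2 \<Rightarrow> (int^2^2) set" where
  "pgl A = {mat 1, - mat 1} #>\<^bsub>GL2Z\<^esub> A"

definition mat_T :: "int^2^2" where
  "mat_T = vector [vector [1, 1], vector [0, 1]]"

definition mat_V :: "int^2^2" where
  "mat_V = vector [vector [-1, 0], vector [0, 1]]"

definition mat_U :: "int^2^2" where
  "mat_U = vector [vector [0, 1], vector [1, 0]]"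

lemma invertible_mat_one: "invertible (mat 1 :: int^2^2)"
  unfolding invertible_def by (rule exI[of _ "mat 1"]) simp

lemma group_GL2Z: "group GL2Z"
proof (rule groupI)
  fix A assume "A \<in> carrier GL2Z"
  then obtain B where "A ** B = mat 1" "B ** A = mat 1"
    by (auto simp: GL2Z_def invertible_def)
  then show "\<exists>B\<in>carrier GL2Z. B \<otimes>\<^bsub>GL2Z\<^esub> A = \<one>\<^bsub>GL2Z\<^esub>"
    by (intro bexI[of _ B]) (auto simp: GL2Z_def invertible_def intro: exI[of _ A])
qed (auto simp: GL2Z_def invertible_mult matrix_mul_assoc invertible_mat_one)

lemma normal_pm_one: "{mat 1, - mat 1} \<lhd> GL2Z"
proof -
  interpret group GL2Z by (rule group_GL2Z)
  have neg: "(- A) ** B = - (A ** B)" "A ** (- B) = - (A ** B)" for A B :: "int^2^2"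
    by (simp_all add: matrix_matrix_mult_def vec_eq_iff sum_negf)
  have minv: "invertible (- mat 1 :: int^2^2)"
    unfolding invertible_def by (rule exI[of _ "- mat 1"]) (simp add: neg)
  have inv1: "inv\<^bsub>GL2Z\<^esub> (- mat 1) = - mat 1"
    using minv by (intro inv_equality) (auto simp: GL2Z_def neg)
  have "subgroup {mat 1, - mat 1} GL2Z"
  proof (rule subgroupI)
    show "{mat 1, - mat 1} \<subseteq> carrier GL2Z"
      using minv one_closed by (auto simp: GL2Z_def)
    show "inv\<^bsub>GL2Z\<^esub> a \<in> {mat 1, - mat 1}" if "a \<in> {mat 1, - mat 1}" for a
      using that inv1 inv_one by (auto simp: GL2Z_def)
    show "a \<otimes>\<^bsub>GL2Z\<^esub> b \<in> {mat 1, - mat 1}"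
      if "a \<in> {mat 1, - mat 1}" "b \<in> {mat 1, - mat 1}" for a b
      using that by (auto simp: GL2Z_def neg)
  qed simp
  then show ?thesis
    by (rule normalI) (auto simp: r_coset_def l_coset_def GL2Z_def neg)
qed

lemma group_PGL2Z: "group PGL2Z"
  unfolding PGL2Z_def by (rule normal.factorgroup_is_group[OF normal_pm_one])

lemma pgl_eq: "pgl A = {A, - A}"
proof -
  have "(- mat 1) ** A = - A"
    using matrix_mul_lid[of A]
    by (simp add: matrix_matrix_mult_def vec_eq_iff sum_negf)
  then show ?thesis by (simp add: pgl_def r_coset_def GL2Z_def insert_commute)
qed

lemma pgl_in_PGL2Z: "invertible A \<Longrightarrow> pgl A \<in> carrier PGL2Z"
  by (auto simp: PGL2Z_def FactGroup_def RCOSETS_def pgl_def GL2Z_def)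

lemma invertible_generators: "invertible mat_T" "invertible mat_V" "invertible mat_U"
  unfolding invertible_def
  by (rule exI[of _ "vector [vector [1, -1], vector [0, 1]]"] exI[of _ mat_V] exI[of _ mat_U],
      simp add: mat_T_def mat_V_def mat_U_def matrix_matrix_mult_def vec_eq_iff forall_2 sum_2 mat_def)+

section \<open>The action on functions\<close>

definition moebius_denom :: "int^2^2 \<Rightarrow> real \<Rightarrow> real" where
  "moebius_denom A x = of_int (A $ 2 $ 1) * x + of_int (A $ 2 $ 2)"

definition moebius_act :: "int^2^2 \<Rightarrow> real \<Rightarrow> real" where
  "moebius_act A x = (of_int (A $ 1 $ 1) * x + of_int (A $ 1 $ 2)) / moebius_denom A x"

text \<open>At the pole the value is the one defined by continuity.\<close>

definition slash_mat :: "nat \<Rightarrow> (real \<Rightarrow> real) \<Rightarrow> int^2^2 \<Rightarrow> real \<Rightarrow> real" where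
  "slash_mat r P A x =
     (let f = (\<lambda>y. moebius_denom A y ^ (2 * r) * P (moebius_act A y))
      in if moebius_denom A x = 0 then Lim (at x) f else f x)"

text \<open>\<open>slash_mat r P A = slash_mat r P (- A)\<close>, so the image below is a singleton for
  \<open>g \<in> carrier PGL2Z\<close>.\<close>

definition slash :: "nat \<Rightarrow> (real \<Rightarrow> real) \<Rightarrow> (int^2^2) set \<Rightarrow> real \<Rightarrow> real" where
  "slash r P g = the_elem (slash_mat r P ` g)"

text \<open>\<open>at_infinity\<close> on the reals is the two-sided limit \<open>x \<rightarrow> \<plusminus>\<infinity>\<close>.\<close>

definition slash_at_inf :: "nat \<Rightarrow> (real \<Rightarrow> real) \<Rightarrow> (int^2^2) set \<Rightarrow> real" where
  "slash_at_inf r P g = Lim at_infinity (\<lambda>x. slash r P g x / x ^ (2 * r))"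

definition slash_sign :: "nat \<Rightarrow> (real \<Rightarrow> real) \<Rightarrow> (int^2^2) set \<Rightarrow> real" where
  "slash_sign r P g = (if slash_at_inf r P g < 0 then 1 else -1)"

definition signed_slash :: "nat \<Rightarrow> (real \<Rightarrow> real) \<Rightarrow> (int^2^2) set \<Rightarrow> real \<Rightarrow> real" where
  "signed_slash r P g x = slash_sign r P g * slash r P g x"

definition stab :: "nat \<Rightarrow> (real \<Rightarrow> real) \<Rightarrow> (int^2^2) set set" where
  "stab r P = {g \<in> carrier PGL2Z. signed_slash r P g = P}"

text \<open>\<open>\<Gamma>\<^sub>P\<setminus>\<Gamma>\<close>, whose elements are the cosets \<open>\<Gamma>\<^sub>P \<gamma>\<close>.\<close>

definition stab_cosets :: "nat \<Rightarrow> (real \<Rightarrow> real) \<Rightarrow> (int^2^2) set set set" where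
  "stab_cosets r P = rcosets\<^bsub>PGL2Z\<^esub> (stab r P)"

text \<open>Under the assumptions on \<open>P\<close> used here, \<open>signed_slash r P\<close> is constant on each coset.\<close>

definition coset_fun :: "nat \<Rightarrow> (real \<Rightarrow> real) \<Rightarrow> (int^2^2) set set \<Rightarrow> real \<Rightarrow> real" where
  "coset_fun r P C = the_elem (signed_slash r P ` C)"

section \<open>Piecewise polynomials\<close>

text \<open>\<open>S\<close> is the finite set of breakpoints; the components of its complement are the pieces.\<close>

definition piecewise_poly :: "nat \<Rightarrow> (real \<Rightarrow> real) \<Rightarrow> bool" where
  "piecewise_poly n f \<longleftrightarrow>
     (\<exists>S. finite S \<and>
        (\<forall>I\<in>components (- S). \<exists>p :: real poly. degree p \<le> n \<and> (\<forall>x\<in>I. f x = poly p x)))"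

section \<open>The series and its reciprocal defect\<close>

definition T_term ::
  "nat \<Rightarrow> (real \<Rightarrow> real) \<Rightarrow> ((int^2^2) set set \<Rightarrow> real \<Rightarrow> real) \<Rightarrow> real \<Rightarrow> (int^2^2) set set \<Rightarrow> real" where
  "T_term r P lam x C = lam C x * max (coset_fun r P C x) 0"

definition T_sum ::
  "nat \<Rightarrow> (real \<Rightarrow> real) \<Rightarrow> ((int^2^2) set set \<Rightarrow> real \<Rightarrow> real) \<Rightarrow> real \<Rightarrow> real" where
  "T_sum r P lam x = (\<Sum>\<^sub>\<infinity>C\<in>stab_cosets r P. T_term r P lam x C)"

definition R_sum ::
  "nat \<Rightarrow> (real \<Rightarrow> real) \<Rightarrow> ((int^2^2) set set \<Rightarrow> real \<Rightarrow> real) \<Rightarrow> real \<Rightarrow> real" where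
  "R_sum r P lam x =
     (\<Sum>C | C \<in> stab_cosets r P \<and> coset_fun r P C 0 > 0. lam C x * coset_fun r P C x)"

end

theory Submission imports Defs begin

text \<open>
Write \<open>Q\<^sub>C\<close> for the function of a coset \<open>C\<close>, and let \<open>S\<close> be the finite set of cosets with
\<open>Q\<^sub>C(0) > 0\<close>. Right multiplication by a generator permutes the cosets, so the symmetries of the
series are reindexings, once it is known how \<open>Q\<^sub>C\<close> transforms: under \<open>x + 1\<close> and \<open>- x\<close> no sign
appears, because these maps fix \<open>\<infinity>\<close>, whereas
\<open>Q\<^bsub>CU\<^esub>(x) = \<plusminus> x\<^sup>2\<^sup>r Q\<^sub>C(1/x)\<close>, with the minus sign exactly for \<open>C \<in> S\<close>. Moreover \<open>U\<close> maps \<open>S\<close> to itself.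
Hence the inversion exchanges the summands outside \<open>S\<close>, and on \<open>S\<close> it replaces the
positive part of \<open>Q\<^sub>C\<close> by its negative part; the difference of the two is \<open>Q\<^sub>C\<close> itself,
which gives the reciprocal equation \<open>T(x) = R(x) + x\<^sup>2\<^sup>r T(1/x)\<close> (\<open>series_reciprocal\<close>).

Both convergence and continuity come from the fact that this equation contracts: after a
translation \<open>\<bar>x\<bar> \<le> 1/2\<close>, where \<open>x\<^sup>2\<^sup>r \<le> 1/4\<close>.

For convergence, take finitely many cosets, all with \<open>Q\<^sub>C > 0\<close> on one ball around \<open>x\<close>,
where \<open>\<bar>x\<bar> \<le> 1/2\<close>. Those in \<open>S\<close> contribute a bounded amount. For the others the ball misses \<open>0\<close>,
and under \<open>x \<mapsto> 1/x\<close> its radius grows by the factor 2 at least, while the summand at \<open>x\<close> is only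
\<open>x\<^sup>2\<^sup>r\<close> times the corresponding one at \<open>1/x\<close>. A ball of radius 1 contains \<open>0\<close> after translation, so this process ends, and the geometric
series of contributions bounds every finite partial sum by a constant that depends neither on the
partial sum nor on \<open>x\<close> (\<open>sum_summand_bound\<close>).

For continuity, the bounded function \<open>T\<close> has a finite oscillation at each point. As \<open>R\<close> is
continuous, the oscillation at \<open>x\<close> is \<open>x\<^sup>2\<^sup>r\<close> times the one at \<open>1/x\<close>, and it vanishes at \<open>0\<close>; so
any bound for all oscillations can be halved, and they are all zero (\<open>self_reciprocal_continuous\<close>).

To compute with \<open>Q\<^sub>C\<close> without treating poles and \<open>\<infinity>\<close> separately, \<open>P\<close> is replaced by its
homogenization \<open>F(x, y) = y\<^sup>2\<^sup>r P(x/y)\<close>, which is continuous away from the origin. Then \<open>P\<^sup>\<gamma>(x)\<close> is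
\<open>F(\<gamma>(x, 1))\<close>, its leading coefficient is \<open>F(\<gamma>(1, 0))\<close>, and \<open>F\<close> does not
vanish at nonzero integer points because the roots are irrational and the leading coefficient \<open>F(1, 0)\<close>
of \<open>P\<close> is not zero.
\<close>

section \<open>Continuity from a contracting functional equation\<close>

text \<open>
Once \<open>x\<close> is translated to \<open>\<bar>x\<bar> \<le> 1/2\<close>, the oscillation of \<open>T\<close> at \<open>x\<close> is \<open>x\<^sup>2\<^sup>r \<le> 1/4\<close> times the one at
\<open>1/x\<close>. Subtracting the nearest integer, rather than the floor as in the regular continued fraction, makes
every single step a contraction.
\<close>

lemma self_reciprocal_continuous:
  fixes T R :: "real \<Rightarrow> real"
  assumes r: "r \<ge> 1"
    and bounded: "\<And>x. \<bar>T x\<bar> \<le> B"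
    and periodic: "\<And>x. T (x + 1) = T x"
    and R: "continuous_on UNIV R"
    and zero: "T 0 = R 0"
    and recip: "\<And>x. x \<noteq> 0 \<Longrightarrow> T x = R x + x ^ (2 * r) * T (1 / x)"
  shows "continuous_on UNIV T"
proof -
  \<comment> \<open>The oscillation of \<open>T\<close> at \<open>x\<close> is at most \<open>K\<close>.\<close>
  define osc_le where "osc_le K x \<longleftrightarrow>
    (\<forall>e>0. eventually (\<lambda>y. \<bar>T y - T x\<bar> \<le> K + e) (nhds x))" for K x
  have B: "B \<ge> 0" using bounded[of 0] by linarith
  have T_int: "T (x + of_int n) = T x" for x n
  proof (induction n rule: int_induct[where k = 0])
    case (step1 i)
    then show ?case using periodic[of "x + of_int i"] by (simp add: add.assoc)
  next
    case (step2 i)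
    then show ?case using periodic[of "x + of_int (i - 1)"] by (simp add: algebra_simps)
  qed simp
  have R_lim: "(R \<longlongrightarrow> R x) (nhds x)" for x
    using R by (simp add: continuous_on_eq_continuous_at isCont_def tendsto_nhds_iff)
  have pow_lim: "((\<lambda>y. y ^ (2 * r)) \<longlongrightarrow> x ^ (2 * r)) (nhds x)" for x :: real
    by (intro tendsto_power filterlim_ident)
  \<comment> \<open>The value is at most \<open>1/4\<close>; the slack makes the bound \<open>1/2\<close> hold on a whole neighbourhood of \<open>x\<close>.\<close>
  have small: "x ^ (2 * r) < 1 / 2" if "\<bar>x\<bar> \<le> 1 / 2" for x :: real
  proof -
    have "x ^ (2 * r) = \<bar>x\<bar> ^ (2 * r)" by (simp add: power_even_abs)
    also have "\<dots> \<le> \<bar>x\<bar> ^ 2" using r that by (intro power_decreasing) auto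
    also have "\<dots> \<le> (1 / 2) ^ 2" using that by (intro power_mono) auto
    finally show ?thesis by (simp add: power2_eq_square)
  qed
  have near: "osc_le (K / 2) x" if K: "\<And>x. osc_le K x" "K \<ge> 0" and x: "\<bar>x\<bar> \<le> 1 / 2" for K x
  proof (cases "x = 0")
    case True
    \<comment> \<open>At \<open>0\<close> the inverted term is \<open>O(y\<^sup>2\<^sup>r)\<close> since \<open>T\<close> is bounded.\<close>
    have "eventually (\<lambda>y. \<bar>T y - T x\<bar> \<le> K / 2 + e) (nhds x)" if e: "e > 0" for e
    proof -
      have "((\<lambda>y. \<bar>R y - R 0\<bar> + y ^ (2 * r) * B) \<longlongrightarrow> \<bar>R 0 - R 0\<bar> + 0 ^ (2 * r) * B) (nhds 0)"
        by (intro tendsto_intros R_lim pow_lim)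
      moreover have "\<bar>R 0 - R 0\<bar> + 0 ^ (2 * r) * B < e" using e r by (simp add: power_0_left)
      ultimately have "eventually (\<lambda>y. \<bar>R y - R 0\<bar> + y ^ (2 * r) * B < e) (nhds 0)"
        by (rule order_tendstoD(2))
      then have "eventually (\<lambda>y. \<bar>T y - T 0\<bar> \<le> K / 2 + e) (nhds 0)"
      proof eventually_elim
        case (elim y)
        show ?case
        proof (cases "y = 0")
          case False
          have "\<bar>y ^ (2 * r) * T (1 / y)\<bar> \<le> y ^ (2 * r) * B"
            using bounded[of "1 / y"] by (simp add: abs_mult power_even_abs mult_left_mono)
          moreover have "T y - T 0 = (R y - R 0) + y ^ (2 * r) * T (1 / y)"
            using recip[OF False] zero by simp
          ultimately show ?thesis using elim K(2) by linarith
        qed (use e K(2) in simp)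
      qed
      then show ?thesis using True by simp
    qed
    then show ?thesis by (auto simp: osc_le_def)
  next
    case False
    have "eventually (\<lambda>y. \<bar>T y - T x\<bar> \<le> K / 2 + e) (nhds x)" if e: "e > 0" for e
    proof -
      have "((\<lambda>y. \<bar>R y - R x\<bar> + \<bar>y ^ (2 * r) - x ^ (2 * r)\<bar> * B) \<longlongrightarrow>
              \<bar>R x - R x\<bar> + \<bar>x ^ (2 * r) - x ^ (2 * r)\<bar> * B) (nhds x)"
        by (intro tendsto_intros R_lim pow_lim)
      then have 1: "eventually (\<lambda>y. \<bar>R y - R x\<bar> + \<bar>y ^ (2 * r) - x ^ (2 * r)\<bar> * B < e / 2) (nhds x)"
        by (rule order_tendstoD(2)) (use e in simp)
      have 2: "eventually (\<lambda>y. y ^ (2 * r) < 1 / 2) (nhds x)"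
        by (rule order_tendstoD(2)[OF pow_lim small[OF x]])
      have 3: "eventually (\<lambda>y. y \<noteq> 0) (nhds x)"
        using False by (intro t1_space_nhds)
      have "filterlim (\<lambda>y. 1 / y) (nhds (1 / x)) (nhds x)"
        using False by (intro tendsto_intros) (auto simp: filterlim_ident)
      moreover have "eventually (\<lambda>z. \<bar>T z - T (1 / x)\<bar> \<le> K + e) (nhds (1 / x))"
        using K(1)[of "1 / x"] e by (simp add: osc_le_def)
      ultimately have 4: "eventually (\<lambda>y. \<bar>T (1 / y) - T (1 / x)\<bar> \<le> K + e) (nhds x)"
        by (rule eventually_compose_filterlim[rotated])
      show ?thesis using 1 2 3 4
      proof eventually_elim
        case (elim y)
        define p q where "p = y ^ (2 * r)" and "q = x ^ (2 * r)"
        have p: "0 \<le> p" "p \<le> 1 / 2" using elim by (auto simp: p_def)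
        define d b c where "d = \<bar>p - q\<bar> * B" and "b = (p - q) * T (1 / x)" and "c = p * (T (1 / y) - T (1 / x))"
        have "T y - T x = (R y - R x) + b + c"
          using recip[OF elim(3)] recip[OF False] by (simp add: algebra_simps p_def q_def b_def c_def)
        moreover have "\<bar>b\<bar> \<le> d"
          using bounded[of "1 / x"] by (simp add: b_def d_def abs_mult mult_left_mono)
        moreover have "\<bar>c\<bar> \<le> (1 / 2) * (K + e)"
          using elim(4) p e K(2) unfolding abs_mult c_def by (intro mult_mono) auto
        moreover have "\<bar>R y - R x\<bar> + d < e / 2"
          using elim(1) by (simp add: p_def q_def d_def)
        moreover have "(1 / 2) * (K + e) = K / 2 + e / 2" by simp
        moreover have "\<bar>(R y - R x) + b + c\<bar> \<le> \<bar>R y - R x\<bar> + \<bar>b\<bar> + \<bar>c\<bar>" by linarith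
        ultimately show ?case by linarith
      qed
    qed
    then show ?thesis by (auto simp: osc_le_def)
  qed
  have halve: "osc_le (K / 2) x" if K: "\<And>x. osc_le K x" "K \<ge> 0" for K x
  proof -
    define z where "z = x - of_int (round x)"
    have z: "\<bar>z\<bar> \<le> 1 / 2" unfolding z_def using of_int_round_abs_le[of x] by (simp add: abs_minus_commute)
    have Tz: "T (y - of_int (round x)) = T y" for y using T_int[of "y - of_int (round x)" "round x"] by simp
    have "filterlim (\<lambda>y. y - of_int (round x)) (nhds z) (nhds x)"
      unfolding z_def by (intro tendsto_intros) (auto simp: filterlim_ident)
    then show ?thesis
      using near[OF K z] eventually_compose_filterlim[of _ "nhds z" "\<lambda>y. y - of_int (round x)" "nhds x"]
      unfolding osc_le_def by (force simp: Tz z_def)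
  qed
  have osc: "osc_le (2 * B / 2 ^ n) x" for n x
  proof (induction n arbitrary: x)
    case 0
    have "\<bar>T y - T x\<bar> \<le> 2 * B + e" if "e > 0" for y e
      using bounded[of x] bounded[of y] that by linarith
    then show ?case by (auto simp: osc_le_def intro!: always_eventually)
  next
    case (Suc n)
    then show ?case using halve[of "2 * B / 2 ^ n" x] B by (simp add: field_simps)
  qed
  have "(T \<longlongrightarrow> T x) (nhds x)" for x
  proof (rule tendstoI)
    fix e :: real assume e: "e > 0"
    have "(\<lambda>n. 2 * B * (1 / 2) ^ n) \<longlonglongrightarrow> 2 * B * 0"
      by (intro tendsto_intros LIMSEQ_power_zero) auto
    then have "eventually (\<lambda>n. 2 * B * (1 / 2) ^ n < e / 2) sequentially"
      by (rule order_tendstoD(2)) (use e in simp)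
    then obtain n where n: "2 * B * (1 / 2) ^ n < e / 2"
      by (auto simp: eventually_sequentially)
    then have n': "2 * B / 2 ^ n < e / 2" by (simp add: power_one_over)
    have "eventually (\<lambda>y. \<bar>T y - T x\<bar> \<le> 2 * B / 2 ^ n + e / 2) (nhds x)"
      using osc[of n x] e by (auto simp: osc_le_def)
    then show "eventually (\<lambda>y. dist (T y) (T x) < e) (nhds x)"
      by eventually_elim (use n' in \<open>simp add: dist_real_def\<close>)
  qed
  then show ?thesis
    by (simp add: continuous_on_eq_continuous_at isCont_def tendsto_nhds_iff)
qed

section \<open>Sums of positive parts over a system stable under translation and inversion\<close>

text \<open>What the series needs of the cosets, of their functions \<open>Q\<close> and of the weights \<open>l\<close>: \<open>shift\<close> and
\<open>invert\<close> stand for right multiplication by \<open>x \<mapsto> x + 1\<close> and \<open>x \<mapsto> 1/x\<close>. The sign in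
\<open>Q_invert\<close> is the one that keeps the functions of cosets negative at infinity: the leading
coefficient of \<open>x ^ (2 * r) * Q C (1 / x)\<close>
is \<open>Q C 0\<close>.\<close>

locale reciprocal_system =
  fixes r :: nat and X :: "'c set" and Q l :: "'c \<Rightarrow> real \<Rightarrow> real"
    and shift invert :: "'c \<Rightarrow> 'c"
  assumes r: "r \<ge> 1"
    and shift_bij: "bij_betw shift X X"
    and invert_bij: "bij_betw invert X X"
    and Q_shift: "\<And>C x. C \<in> X \<Longrightarrow> Q (shift C) x = Q C (x + 1)"
    and l_shift: "\<And>C x. C \<in> X \<Longrightarrow> l (shift C) x = l C (x + 1)"
    and Q_invert: "\<And>C x. C \<in> X \<Longrightarrow> x \<noteq> 0 \<Longrightarrow>
          Q (invert C) x = (if Q C 0 > 0 then - 1 else 1) * (x ^ (2 * r) * Q C (1 / x))"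
    and Q_invert_zero: "\<And>C. C \<in> X \<Longrightarrow> Q (invert C) 0 > 0 \<longleftrightarrow> Q C 0 > 0"
    and l_invert: "\<And>C x. C \<in> X \<Longrightarrow> x \<noteq> 0 \<Longrightarrow> l (invert C) x = l C (1 / x)"
    and l_nonneg: "\<And>C x. C \<in> X \<Longrightarrow> l C x \<ge> 0"
    and Q_cont: "\<And>C. C \<in> X \<Longrightarrow> continuous_on UNIV (Q C)"
    and lQ_cont: "\<And>C. C \<in> X \<Longrightarrow> continuous_on UNIV (\<lambda>x. l C x * Q C x)"
    and finite_at_zero: "finite {C \<in> X. Q C 0 > 0}"
begin

definition "positive_at_zero = {C \<in> X. Q C 0 > 0}"
definition "summand x C = l C x * max (Q C x) 0"
definition "series x = (\<Sum>\<^sub>\<infinity>C\<in>X. summand x C)"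
definition "defect x = (\<Sum>C\<in>positive_at_zero. l C x * Q C x)"

lemma finite_positive_at_zero: "finite positive_at_zero" and positive_at_zero_subset: "positive_at_zero \<subseteq> X"
  using finite_at_zero by (auto simp: positive_at_zero_def)

lemma summand_nonneg: "C \<in> X \<Longrightarrow> summand x C \<ge> 0"
  by (simp add: summand_def l_nonneg)

lemma shift_in: "C \<in> X \<Longrightarrow> shift C \<in> X"
  using shift_bij by (auto simp: bij_betw_def)

lemma invert_in: "C \<in> X \<Longrightarrow> invert C \<in> X"
  using invert_bij by (auto simp: bij_betw_def)

lemma summand_shift: "C \<in> X \<Longrightarrow> summand x (shift C) = summand (x + 1) C"
  by (simp add: summand_def Q_shift l_shift)

text \<open>Outside \<open>positive_at_zero\<close> no sign appears, so inversion commutes with taking the positive part.\<close>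

lemma summand_invert:
  assumes "C \<in> X" "x \<noteq> 0" "C \<notin> positive_at_zero"
  shows "summand x (invert C) = x ^ (2 * r) * summand (1 / x) C"
proof -
  have "max (x ^ (2 * r) * Q C (1 / x)) 0 = x ^ (2 * r) * max (Q C (1 / x)) 0"
    by (simp add: max_mult_distrib_left)
  then show ?thesis using assms by (simp add: summand_def Q_invert l_invert positive_at_zero_def)
qed

text \<open>Translations move any \<open>x\<close> to within \<open>1/2\<close> of \<open>0\<close>, at the price of moving the set of indices by \<open>shift\<close>;
hence the set has to vary along with the point.\<close>

lemma reduce_mod_one:
  fixes \<Phi> :: "real \<Rightarrow> 'c set \<Rightarrow> bool"
  assumes "\<And>x F. F \<subseteq> X \<Longrightarrow> \<Phi> (x + 1) F \<longleftrightarrow> \<Phi> x (shift ` F)"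
    and base: "\<And>x F. \<bar>x\<bar> \<le> 1 / 2 \<Longrightarrow> F \<subseteq> X \<Longrightarrow> \<Phi> x F"
    and F: "F \<subseteq> X"
  shows "\<Phi> x F"
proof -
  have "\<Phi> (z + of_int n) F" if "\<bar>z\<bar> \<le> 1 / 2" "F \<subseteq> X" for z n F
    using that(2)
  proof (induction n arbitrary: F rule: int_induct[where k = 0])
    case base
    then show ?case using assms(2) that(1) by simp
  next
    case (step1 i)
    have "\<Phi> (z + of_int i) (shift ` F)" using step1(3) shift_in by (intro step1(2)) auto
    then show ?case using assms(1)[OF step1(3), of "z + of_int i"] by (simp add: add.assoc)
  next
    case (step2 i)
    have "F \<subseteq> shift ` X" using step2(3) shift_bij by (simp add: bij_betw_def)
    then obtain G where G: "G \<subseteq> X" "F = shift ` G" by (auto simp: subset_image_iff)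
    then show ?case using step2(2)[OF G(1)] assms(1)[OF G(1), of "z + of_int (i - 1)"]
      by (simp add: algebra_simps)
  qed
  from this[of "x - of_int (round x)" F "round x"] F show ?thesis
    using of_int_round_abs_le[of x] by (simp add: abs_minus_commute)
qed

text \<open>A quantitative form of the statement that each index with \<open>Q C x > 0\<close> reaches \<open>positive_at_zero\<close> after
finitely many translations and inversions, for which the radius of a ball of positivity is the
measure of progress. Let \<open>\<bar>x\<bar> \<le> 1/2\<close> and let \<open>0\<close> lie outside the ball of radius \<open>d\<close> around \<open>x\<close>, so that
\<open>d \<le> 1/2\<close>. If \<open>\<bar>y - 1/x\<bar> < 2d\<close>, then \<open>\<bar>y\<bar> > 2 - 2d \<ge> 1\<close> and
\<open>\<bar>1/y - x\<bar> = \<bar>x\<bar> \<bar>y - 1/x\<bar> / \<bar>y\<bar> < d\<close>: the image of the ball contains the ball of radius \<open>2d\<close> around \<open>1/x\<close>.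
The constant \<open>2 * M\<close> is the fixed point of the recursion \<open>B \<mapsto> M + B / 2\<close>.\<close>

lemma sum_summand_bound:
  assumes M: "\<And>x. \<bar>x\<bar> \<le> 1 / 2 \<Longrightarrow> sum (summand x) positive_at_zero \<le> M"
    and F: "F \<subseteq> X" and fin: "finite F"
    and pos: "\<And>C y. C \<in> F \<Longrightarrow> \<bar>y - x\<bar> < 1 / 2 ^ n \<Longrightarrow> Q C y > 0"
  shows "sum (summand x) F \<le> 2 * M"
proof -
  have M0: "M \<ge> 0" using M[of 0] sum_nonneg[of positive_at_zero "summand 0"] summand_nonneg positive_at_zero_subset by force
  \<comment> \<open>The two assumptions on \<open>F\<close> belong to the predicate because \<open>F\<close> moves under translation.\<close>
  define \<Phi> where "\<Phi> n x F \<longleftrightarrow> finite F \<longrightarrow> (\<forall>C\<in>F. \<forall>y. \<bar>y - x\<bar> < 1 / 2 ^ n \<longrightarrow> Q C y > 0) \<longrightarrow>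
      sum (summand x) F \<le> 2 * M" for n x F
  have shift: "\<Phi> n (x + 1) F \<longleftrightarrow> \<Phi> n x (shift ` F)" if "F \<subseteq> X" for n x F
  proof -
    have inj: "inj_on shift F" using shift_bij that by (auto simp: bij_betw_def intro: inj_on_subset)
    have "sum (summand x) (shift ` F) = sum (summand (x + 1)) F"
      using that by (subst sum.reindex[OF inj]) (auto intro!: sum.cong simp: summand_shift)
    moreover have "(\<forall>y. \<bar>y - x\<bar> < 1 / 2 ^ n \<longrightarrow> Q (shift C) y > 0) \<longleftrightarrow>
        (\<forall>y. \<bar>y - (x + 1)\<bar> < 1 / 2 ^ n \<longrightarrow> Q C y > 0)" if "C \<in> X" for C
    proof (intro iffI allI impI)
      fix y assume "\<forall>y. \<bar>y - x\<bar> < 1 / 2 ^ n \<longrightarrow> Q (shift C) y > 0" "\<bar>y - (x + 1)\<bar> < 1 / 2 ^ n"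
      then show "Q C y > 0" using Q_shift[OF that, of "y - 1"] by (auto dest!: spec[of _ "y - 1"] simp: algebra_simps)
    qed (simp add: Q_shift[OF that])
    ultimately show ?thesis using that by (auto simp: \<Phi>_def finite_image_iff[OF inj] subset_iff)
  qed
  have "\<Phi> n x F" if "F \<subseteq> X" for n x F using that
  proof (induction n arbitrary: x F)
    case 0
    show ?case
    proof (rule reduce_mod_one[of "\<Phi> 0", OF shift _ 0])
      fix x :: real and F assume x: "\<bar>x\<bar> \<le> 1 / 2" and F: "F \<subseteq> X"
      show "\<Phi> 0 x F" unfolding \<Phi>_def
      proof (intro impI)
        assume fin: "finite F" and pos: "\<forall>C\<in>F. \<forall>y. \<bar>y - x\<bar> < 1 / 2 ^ 0 \<longrightarrow> Q C y > 0"
        \<comment> \<open>A ball of radius 1 around a point within \<open>1/2\<close> of \<open>0\<close> contains \<open>0\<close>.\<close>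
        have "F \<subseteq> positive_at_zero" using pos[rule_format, of _ 0] x F by (auto simp: positive_at_zero_def)
        then have "sum (summand x) F \<le> sum (summand x) positive_at_zero"
          using positive_at_zero_subset by (intro sum_mono2 finite_positive_at_zero) (auto intro: summand_nonneg)
        then show "sum (summand x) F \<le> 2 * M" using M[OF x] M0 by linarith
      qed
    qed
  next
    case (Suc n)
    show ?case
    proof (rule reduce_mod_one[of "\<Phi> (Suc n)", OF shift _ Suc(2)])
      fix x :: real and F assume x: "\<bar>x\<bar> \<le> 1 / 2" and F: "F \<subseteq> X"
      show "\<Phi> (Suc n) x F" unfolding \<Phi>_def
      proof (intro impI)
        assume fin: "finite F" and pos: "\<forall>C\<in>F. \<forall>y. \<bar>y - x\<bar> < 1 / 2 ^ Suc n \<longrightarrow> Q C y > 0"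
        define G where "G = F - positive_at_zero"
        have G: "G \<subseteq> X" "finite G" using F fin by (auto simp: G_def)
        have "sum (summand x) (F \<inter> positive_at_zero) \<le> sum (summand x) positive_at_zero"
          using positive_at_zero_subset by (intro sum_mono2 finite_positive_at_zero) (auto intro: summand_nonneg)
        also have "\<dots> \<le> M" by (rule M[OF x])
        finally have 1: "sum (summand x) (F \<inter> positive_at_zero) \<le> M" .
        have 2: "sum (summand x) G \<le> M"
        proof (cases "G = {}")
          case False
          have far: "1 / 2 ^ Suc n \<le> \<bar>x\<bar>"
          proof (rule ccontr)
            assume "\<not> 1 / 2 ^ Suc n \<le> \<bar>x\<bar>"
            then have "Q C 0 > 0" if "C \<in> F" for C using pos that by (auto dest!: bspec spec[of _ 0])
            then show False using False F by (auto simp: G_def positive_at_zero_def)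
          qed
          moreover have "(0::real) < 1 / 2 ^ Suc n" by simp
          ultimately have x0: "x \<noteq> 0" by linarith
          have inj: "inj_on invert G" using invert_bij G by (auto simp: bij_betw_def intro: inj_on_subset)
          \<comment> \<open>Inversion doubles the radius of the ball of positivity.\<close>
          have "Q (invert C) y > 0" if C: "C \<in> G" and y: "\<bar>y - 1 / x\<bar> < 1 / 2 ^ n" for C y
          proof -
            have half: "(1::real) / 2 ^ n \<le> 1" by simp
            have "\<bar>1 / x\<bar> \<ge> 2" using x x0 by (simp add: field_simps)
            then have y1: "\<bar>y\<bar> > 1" using y half by linarith
            then have y0: "y \<noteq> 0" by auto
            have "1 / y - x = - x * (y - 1 / x) / y" using y0 x0 by (simp add: field_simps)
            then have "\<bar>1 / y - x\<bar> = \<bar>x\<bar> * \<bar>y - 1 / x\<bar> / \<bar>y\<bar>" by (simp add: abs_mult)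
            also have "\<dots> \<le> \<bar>x\<bar> * \<bar>y - 1 / x\<bar>" 
              using y1 mult_right_mono[of 1 "\<bar>y\<bar>" "\<bar>x\<bar> * \<bar>y - 1 / x\<bar>"]
              by (simp add: divide_le_eq mult.commute)
            also have "\<dots> \<le> 1 / 2 * \<bar>y - 1 / x\<bar>" using x by (intro mult_right_mono) auto
            also have "\<dots> < 1 / 2 ^ Suc n" using y by simp
            finally have "Q C (1 / y) > 0" using pos C by (auto simp: G_def)
            moreover have "y ^ (2 * r) > 0" using y0 by (simp add: zero_less_power_eq)
            moreover have "\<not> Q C 0 > 0" "C \<in> X" using C G by (auto simp: G_def positive_at_zero_def)
            ultimately show ?thesis using y0 by (simp add: Q_invert)
          qed
          then have "sum (summand (1 / x)) (invert ` G) \<le> 2 * M"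
            using Suc(1)[of "invert ` G" "1 / x"] G invert_in by (auto simp: \<Phi>_def)
          \<comment> \<open>Going back from \<open>1/x\<close> to \<open>x\<close> divides the sum by \<open>(1 / x) ^ (2 * r) \<ge> 2\<close>.\<close>
          also have "sum (summand (1 / x)) (invert ` G) = (\<Sum>C\<in>G. (1 / x) ^ (2 * r) * summand x C)"
            using G x0 by (subst sum.reindex[OF inj]) (auto intro!: sum.cong simp: summand_invert G_def subset_iff)
          also have "\<dots> = (1 / x) ^ (2 * r) * sum (summand x) G" by (simp add: sum_distrib_left)
          finally have "(1 / x) ^ (2 * r) * sum (summand x) G \<le> 2 * M" .
          moreover have "2 * sum (summand x) G \<le> (1 / x) ^ (2 * r) * sum (summand x) G"
          proof (rule mult_right_mono)
            have a: "\<bar>1 / x\<bar> \<ge> 2" using x x0 by (simp add: field_simps)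
            then have "2 \<le> \<bar>1 / x\<bar> ^ 1" by simp
            also have "\<dots> \<le> \<bar>1 / x\<bar> ^ (2 * r)" using a r by (intro power_increasing) auto
            finally show "2 \<le> (1 / x) ^ (2 * r)" by (simp only: power_even_abs even_mult_iff even_numeral simp_thms)
          qed (use G summand_nonneg in \<open>auto intro!: sum_nonneg\<close>)
          ultimately show ?thesis by linarith
        qed (use M0 in simp)
        have "sum (summand x) F = sum (summand x) (F \<inter> positive_at_zero) + sum (summand x) G"
          unfolding G_def using fin by (rule sum.Int_Diff)
        then show "sum (summand x) F \<le> 2 * M" using 1 2 by linarith
      qed
    qed
  qed
  then have "\<Phi> n x F" using F by blast
  then show ?thesis using fin pos by (simp add: \<Phi>_def)
qed

text \<open>An index with \<open>Q C x \<le> 0\<close> contributes nothing; for the others, finitely many in a partial sum,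
continuity of \<open>Q C\<close> at \<open>x\<close> provides a common ball of positivity, of whatever radius. The bound of
\<open>sum_summand_bound\<close> does not depend on this radius.\<close>

lemma finite_sums_bounded:
  obtains B where "\<And>x F. F \<subseteq> X \<Longrightarrow> finite F \<Longrightarrow> sum (summand x) F \<le> B"
proof -
  have "continuous_on UNIV (\<lambda>x. summand x C)" if "C \<in> positive_at_zero" for C
  proof -
    have C: "C \<in> X" using that by (simp add: positive_at_zero_def)
    have "(\<lambda>x. summand x C) = (\<lambda>x. max (l C x * Q C x) 0)"
      using l_nonneg[OF C] by (simp add: summand_def max_mult_distrib_left)
    then show ?thesis using continuous_on_max[OF lQ_cont[OF C] continuous_on_const[of UNIV 0]] by (simp only:)
  qed
  then have "continuous_on UNIV (\<lambda>x. sum (summand x) positive_at_zero)" by (intro continuous_on_sum)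
  then have "compact ((\<lambda>x. sum (summand x) positive_at_zero) ` {- 1 / 2 .. 1 / 2})"
    by (intro compact_continuous_image) (auto intro: continuous_on_subset)
  then obtain M where M: "\<And>x. x \<in> {- 1 / 2 .. 1 / 2} \<Longrightarrow> sum (summand x) positive_at_zero \<le> M"
    by (meson bdd_above.unfold bounded_imp_bdd_above compact_imp_bounded image_eqI)
  have "sum (summand x) F \<le> 2 * M" if F: "F \<subseteq> X" "finite F" for x F
  proof -
    define G where "G = {C \<in> F. Q C x > 0}"
    have G: "G \<subseteq> X" "finite G" using F by (auto simp: G_def)
    have ball: "eventually (\<lambda>n. \<forall>y. \<bar>y - x\<bar> < 1 / 2 ^ n \<longrightarrow> Q C y > 0) sequentially" if C: "C \<in> G" for C
    proof -
      have "isCont (Q C) x" using Q_cont[of C] C G by (auto simp: continuous_on_eq_continuous_at)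
      then have "(Q C \<longlongrightarrow> Q C x) (nhds x)" by (simp add: isCont_def tendsto_nhds_iff)
      then have "eventually (\<lambda>y. Q C y > 0) (nhds x)"
        by (rule order_tendstoD(1)) (use C in \<open>simp add: G_def\<close>)
      then obtain d where d: "d > 0" "\<And>y. \<bar>y - x\<bar> < d \<Longrightarrow> Q C y > 0"
        by (auto simp: eventually_nhds_metric dist_real_def)
      have "(\<lambda>n. (1 / 2 :: real) ^ n) \<longlonglongrightarrow> 0" by (intro LIMSEQ_power_zero) auto
      then have "eventually (\<lambda>n. (1 / 2 :: real) ^ n < d) sequentially"
        by (rule order_tendstoD(2)) (use d in simp)
      then show ?thesis by eventually_elim (use d in \<open>auto simp: power_one_over\<close>)
    qed
    have "eventually (\<lambda>n. \<forall>C\<in>G. \<forall>y. \<bar>y - x\<bar> < 1 / 2 ^ n \<longrightarrow> Q C y > 0) sequentially"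
      using ball by (intro eventually_ball_finite G) auto
    then obtain n where n: "\<forall>C\<in>G. \<forall>y. \<bar>y - x\<bar> < 1 / 2 ^ n \<longrightarrow> Q C y > 0"
      by (auto simp: eventually_sequentially)
    have "sum (summand x) F = sum (summand x) G"
      using F by (intro sum.mono_neutral_right) (auto simp: G_def summand_def)
    also have "\<dots> \<le> 2 * M" by (rule sum_summand_bound[OF M G, of x n]) (use n in auto)
    finally show ?thesis .
  qed
  then show thesis by (rule that)
qed

lemma summable: "summand x summable_on X"
proof -
  obtain B where "\<And>x F. F \<subseteq> X \<Longrightarrow> finite F \<Longrightarrow> sum (summand x) F \<le> B"
    using finite_sums_bounded by blast
  then show ?thesis
    by (intro nonneg_bdd_above_summable_on) (auto simp: summand_nonneg bdd_above_def)
qed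

lemma series_bounded: obtains B where "\<And>x. \<bar>series x\<bar> \<le> B"
proof -
  obtain B where B: "\<And>x F. F \<subseteq> X \<Longrightarrow> finite F \<Longrightarrow> sum (summand x) F \<le> B"
    using finite_sums_bounded by blast
  have "series x \<le> B" for x
    unfolding series_def by (rule infsum_le_finite_sums[OF summable]) (use B in auto)
  moreover have "series x \<ge> 0" for x
    unfolding series_def by (intro infsum_nonneg summand_nonneg)
  ultimately show thesis using that[of B] by simp
qed

lemma series_periodic: "series (x + 1) = series x"
proof -
  have "series x = (\<Sum>\<^sub>\<infinity>C\<in>X. summand x (shift C))"
    unfolding series_def by (rule infsum_reindex_bij_betw[OF shift_bij, symmetric])
  then show ?thesis by (simp add: series_def summand_shift cong: infsum_cong)
qed

text \<open>Reindexing by \<open>invert\<close> turns the left side into the series with the summands of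
\<open>positive_at_zero\<close> replaced by negative parts, and \<open>max (- q) 0 - max q 0 = - q\<close>.\<close>

lemma series_reciprocal:
  assumes x: "x \<noteq> 0"
  shows "x ^ (2 * r) * series (1 / x) = series x - defect x"
proof -
  \<comment> \<open>\<open>g\<close> is the summand of the inverted series at the reindexed place, \<open>h\<close> its difference from the original summand.\<close>
  define g where "g D = (if Q D 0 > 0 then l D x * max (- Q D x) 0 else summand x D)" for D
  define h where "h D = (if D \<in> positive_at_zero then - (l D x * Q D x) else 0)" for D
  have gh: "g D = summand x D + h D" if "D \<in> X" for D
    using that by (auto simp: g_def h_def positive_at_zero_def summand_def max_def)
  have inv: "x ^ (2 * r) * summand (1 / x) C = g (invert C)" if C: "C \<in> X" for C
  proof (cases "C \<in> positive_at_zero")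
    case True
    have "max (x ^ (2 * r) * Q C (1 / x)) 0 = x ^ (2 * r) * max (Q C (1 / x)) 0"
      by (simp add: max_mult_distrib_left)
    then show ?thesis
      using True C x by (simp add: g_def summand_def positive_at_zero_def Q_invert_zero Q_invert l_invert)
  next
    case False
    then show ?thesis
      using C x summand_invert[OF C x False] Q_invert_zero[OF C] by (simp add: g_def positive_at_zero_def)
  qed
  have h_sum: "h summable_on X" "infsum h X = sum h positive_at_zero"
  proof -
    have "h summable_on positive_at_zero" using finite_positive_at_zero by (rule summable_on_finite)
    then show "h summable_on X"
      by (subst summable_on_cong_neutral[of positive_at_zero X h h]) (use positive_at_zero_subset in \<open>auto simp: h_def\<close>)
    have "infsum h X = infsum h positive_at_zero"
      by (rule infsum_cong_neutral) (use positive_at_zero_subset in \<open>auto simp: h_def\<close>)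
    then show "infsum h X = sum h positive_at_zero" using finite_positive_at_zero by simp
  qed
  have "x ^ (2 * r) * series (1 / x) = (\<Sum>\<^sub>\<infinity>C\<in>X. x ^ (2 * r) * summand (1 / x) C)"
    unfolding series_def by (rule infsum_cmult_right'[symmetric])
  also have "\<dots> = (\<Sum>\<^sub>\<infinity>C\<in>X. g (invert C))" by (rule infsum_cong) (rule inv)
  also have "\<dots> = infsum g X" by (rule infsum_reindex_bij_betw[OF invert_bij])
  also have "\<dots> = (\<Sum>\<^sub>\<infinity>D\<in>X. summand x D + h D)" by (rule infsum_cong) (rule gh)
  also have "\<dots> = series x + sum h positive_at_zero"
    unfolding series_def using h_sum by (subst infsum_add[OF summable h_sum(1)]) simp
  also have "sum h positive_at_zero = - defect x" by (simp add: defect_def h_def sum_negf)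
  finally show ?thesis by simp
qed

lemma series_zero: "series 0 = defect 0"
proof -
  have "series 0 = infsum (summand 0) positive_at_zero"
    unfolding series_def by (rule infsum_cong_neutral) (use positive_at_zero_subset in \<open>auto simp: summand_def positive_at_zero_def\<close>)
  then show ?thesis
    using finite_positive_at_zero by (auto simp: defect_def summand_def positive_at_zero_def intro!: sum.cong)
qed

lemma series_continuous: "continuous_on UNIV series"
proof -
  obtain B where "\<And>x. \<bar>series x\<bar> \<le> B" using series_bounded by blast
  moreover have "continuous_on UNIV defect"
    unfolding defect_def using positive_at_zero_subset by (intro continuous_on_sum lQ_cont) auto
  ultimately show ?thesis
    using r series_periodic series_zero series_reciprocal
    by (intro self_reciprocal_continuous[of r series B defect]) auto
qed

end

section \<open>The group of integer matrices modulo sign\<close>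

text \<open>\<open>row1 A\<close> and \<open>row2 A\<close> are the coordinates of the linear action of \<open>A\<close> on \<open>(x, y)\<close>, as separate real
functions because an integer matrix cannot multiply a real vector directly.\<close>

definition row1 :: "int^2^2 \<Rightarrow> real \<Rightarrow> real \<Rightarrow> real" where
  "row1 A x y = of_int (A $ 1 $ 1) * x + of_int (A $ 1 $ 2) * y"

definition row2 :: "int^2^2 \<Rightarrow> real \<Rightarrow> real \<Rightarrow> real" where
  "row2 A x y = of_int (A $ 2 $ 1) * x + of_int (A $ 2 $ 2) * y"

lemma invertible_det_nonzero:
  fixes A :: "int^2^2"
  assumes "invertible A"
  shows "A $ 1 $ 1 * A $ 2 $ 2 - A $ 1 $ 2 * A $ 2 $ 1 \<noteq> 0"
proof -
  from assms obtain B where "A ** B = mat 1" by (auto simp: invertible_def)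
  then have "det A * det B = 1" by (metis det_mul det_I)
  then have "det A \<noteq> 0" by auto
  then show ?thesis by (simp add: det_2)
qed

lemma rows_nonzero:
  assumes "invertible A" "x \<noteq> 0 \<or> y \<noteq> 0"
  shows "row1 A x y \<noteq> 0 \<or> row2 A x y \<noteq> 0"
proof (rule ccontr)
  assume "\<not> ?thesis"
  then have z: "row1 A x y = 0" "row2 A x y = 0" by auto
  define D :: real where "D = of_int (A $ 1 $ 1 * A $ 2 $ 2 - A $ 1 $ 2 * A $ 2 $ 1)"
  have "D \<noteq> 0" using invertible_det_nonzero[OF assms(1)] unfolding D_def by (simp only: of_int_eq_0_iff not_False_eq_True)
  moreover have "D * x = of_int (A $ 2 $ 2) * row1 A x y - of_int (A $ 1 $ 2) * row2 A x y"
    by (simp add: D_def row1_def row2_def algebra_simps)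
  moreover have "D * y = of_int (A $ 1 $ 1) * row2 A x y - of_int (A $ 2 $ 1) * row1 A x y"
    by (simp add: D_def row1_def row2_def algebra_simps)
  ultimately show False using z assms(2) by simp
qed

lemma row_mult:
  "row1 (A ** B) x y = row1 A (row1 B x y) (row2 B x y)"
  "row2 (A ** B) x y = row2 A (row1 B x y) (row2 B x y)"
  by (simp_all add: row1_def row2_def matrix_matrix_mult_def sum_2 algebra_simps)

text \<open>The product in the quotient group is a product of sets; this reduces it to matrices.\<close>

lemma pgl_mult:
  assumes "invertible A" "invertible B"
  shows "pgl A \<otimes>\<^bsub>PGL2Z\<^esub> pgl B = pgl (A ** B)"
proof -
  have "pgl A <#>\<^bsub>GL2Z\<^esub> pgl B = pgl (A ** B)"
    using normal.rcos_sum[OF normal_pm_one, of A B] assms by (simp add: pgl_def GL2Z_def)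
  then show ?thesis by (simp add: PGL2Z_def FactGroup_def)
qed

lemma PGL2Z_cases:
  assumes "g \<in> carrier PGL2Z"
  obtains A where "invertible A" "g = pgl A"
  using assms by (auto simp: PGL2Z_def FactGroup_def RCOSETS_def pgl_def GL2Z_def)

lemma pgl_one: "\<one>\<^bsub>PGL2Z\<^esub> = pgl (mat 1)"
  by (simp add: PGL2Z_def FactGroup_def pgl_eq)

lemma mat_entries:
  "mat_T $ 1 $ 1 = 1" "mat_T $ 1 $ 2 = 1" "mat_T $ 2 $ 1 = 0" "mat_T $ 2 $ 2 = 1"
  "mat_V $ 1 $ 1 = - 1" "mat_V $ 1 $ 2 = 0" "mat_V $ 2 $ 1 = 0" "mat_V $ 2 $ 2 = 1"
  "mat_U $ 1 $ 1 = 0" "mat_U $ 1 $ 2 = 1" "mat_U $ 2 $ 1 = 1" "mat_U $ 2 $ 2 = 0"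
  by (simp_all add: mat_T_def mat_V_def mat_U_def)

section \<open>The homogenization and its twists\<close>

text \<open>The value \<open>L\<close> is the leading coefficient of \<open>P\<close>, which is the value of the homogenization at
\<open>(1, 0)\<close>. Together with \<open>L < 0\<close>, the irrationality of the roots makes all twisted functions nonzero at \<open>0\<close> and at infinity.\<close>

locale binary_form =
  fixes r :: nat and P :: "real \<Rightarrow> real" and L :: real
  assumes P_cont: "continuous_on UNIV P"
    and P_lim: "((\<lambda>x. P x / x ^ (2 * r)) \<longlongrightarrow> L) at_infinity"
    and L_neg: "L < 0"
    and roots_irrational: "\<And>x. x \<in> \<rat> \<Longrightarrow> P x \<noteq> 0"
begin

definition form :: "real \<Rightarrow> real \<Rightarrow> real" where
  "form x y = (if y = 0 then L * x ^ (2 * r) else y ^ (2 * r) * P (x / y))"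

lemma form_one: "form x 1 = P x" and form_infinity: "form 1 0 = L"
  by (simp_all add: form_def)

lemma form_scale: "t \<noteq> 0 \<Longrightarrow> form (t * x) (t * y) = t ^ (2 * r) * form x y"
  by (simp add: form_def power_mult_distrib)

text \<open>Continuity away from the origin. Where \<open>y \<noteq> 0\<close> it is continuity of \<open>P\<close>. Near \<open>(a, 0)\<close> the other chart is
used: \<open>form x y = x\<^sup>2\<^sup>r k(y/x)\<close>, where \<open>k(s) = s\<^sup>2\<^sup>r P(1/s)\<close> extends continuously to \<open>s = 0\<close> by
the value \<open>L\<close>.\<close>

lemma tendsto_form:
  assumes f: "(f \<longlongrightarrow> a) F" and g: "(g \<longlongrightarrow> b) F" and ab: "a \<noteq> 0 \<or> b \<noteq> 0"
  shows "((\<lambda>z. form (f z) (g z)) \<longlongrightarrow> form a b) F"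
proof (cases "b = 0")
  case False
  have "isCont P (a / b)" using P_cont by (simp add: continuous_on_eq_continuous_at)
  then have "((\<lambda>z. g z ^ (2 * r) * P (f z / g z)) \<longlongrightarrow> b ^ (2 * r) * P (a / b)) F"
    by (intro tendsto_intros g isCont_tendsto_compose[of _ P] f False)
  moreover have "eventually (\<lambda>z. g z ^ (2 * r) * P (f z / g z) = form (f z) (g z)) F"
    using tendsto_imp_eventually_ne[OF g False] by eventually_elim (simp add: form_def)
  ultimately show ?thesis using False by (simp add: form_def Lim_transform_eventually)
next
  case True
  then have a: "a \<noteq> 0" using ab by simp
  \<comment> \<open>The function \<open>P\<close> in the coordinate at infinity.\<close>
  define k where "k s = (if s = 0 then L else P (1 / s) / (1 / s) ^ (2 * r))" for s
  have "filterlim (\<lambda>s::real. 1 / s) at_infinity (at 0)"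
    using filterlim_inverse_at_infinity[where 'a = real] by (simp add: divide_inverse)
  from filterlim_compose[OF P_lim this] have "(k \<longlongrightarrow> L) (at 0)"
    by (rule Lim_transform_eventually) (auto simp: k_def eventually_at_filter)
  then have "isCont k 0" by (simp add: isCont_def k_def)
  moreover have "((\<lambda>z. g z / f z) \<longlongrightarrow> 0) F"
    using tendsto_divide[OF g f a] True by simp
  ultimately have "((\<lambda>z. k (g z / f z)) \<longlongrightarrow> k 0) F"
    by (rule isCont_tendsto_compose)
  then have "((\<lambda>z. k (g z / f z) * f z ^ (2 * r)) \<longlongrightarrow> k 0 * a ^ (2 * r)) F"
    by (intro tendsto_intros f)
  moreover have "eventually (\<lambda>z. k (g z / f z) * f z ^ (2 * r) = form (f z) (g z)) F"
    using tendsto_imp_eventually_ne[OF f a] by eventually_elim (simp add: form_def k_def power_divide)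
  ultimately show ?thesis using True by (simp add: form_def k_def Lim_transform_eventually)
qed

lemma form_rational_nonzero:
  assumes "m \<noteq> 0 \<or> n \<noteq> 0"
  shows "form (of_int m) (of_int n) \<noteq> 0"
  using assms L_neg roots_irrational[of "of_int m / of_int n"] by (auto simp: form_def)

definition twist :: "int^2^2 \<Rightarrow> real \<Rightarrow> real \<Rightarrow> real" where
  "twist A x y = form (row1 A x y) (row2 A x y)"

lemma twist_scale: "t \<noteq> 0 \<Longrightarrow> twist A (t * x) (t * y) = t ^ (2 * r) * twist A x y"
  using form_scale[of t "row1 A x y" "row2 A x y"]
  by (simp add: twist_def row1_def row2_def algebra_simps)

lemma tendsto_twist:
  assumes "invertible A" "(f \<longlongrightarrow> a) F" "(g \<longlongrightarrow> b) F" "a \<noteq> 0 \<or> b \<noteq> 0"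
  shows "((\<lambda>z. twist A (f z) (g z)) \<longlongrightarrow> twist A a b) F"
  unfolding twist_def
  by (rule tendsto_form) (use assms rows_nonzero[of A a b] in \<open>auto simp: row1_def row2_def intro!: tendsto_intros\<close>)

lemma twist_rational_nonzero:
  assumes "invertible A"
  shows "twist A 1 0 \<noteq> 0" "twist A 0 1 \<noteq> 0"
  using rows_nonzero[OF assms, of 1 0] rows_nonzero[OF assms, of 0 1]
  by (auto simp: twist_def row1_def row2_def intro!: form_rational_nonzero)

section \<open>The slash action in terms of the form\<close>

text \<open>Away from the pole the formula is homogeneity. At the pole the value is a limit, and since \<open>twist A\<close> is
continuous the same formula holds there.\<close>

lemma slash_mat_eq_twist:
  assumes "invertible A"
  shows "slash_mat r P A x = twist A x 1"
proof -
  define f where "f = (\<lambda>y. moebius_denom A y ^ (2 * r) * P (moebius_act A y))"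
  have f: "f y = twist A y 1" if "moebius_denom A y \<noteq> 0" for y
    using that by (simp add: f_def twist_def form_def moebius_denom_def moebius_act_def row1_def row2_def)
  show ?thesis
  proof (cases "moebius_denom A x = 0")
    case True
    have c: "A $ 2 $ 1 \<noteq> 0"
    proof
      assume "A $ 2 $ 1 = 0"
      then show False using True invertible_det_nonzero[OF assms] by (simp add: moebius_denom_def)
    qed
    have "((\<lambda>y. twist A y 1) \<longlongrightarrow> twist A x 1) (at x)"
      by (rule tendsto_twist[OF assms]) auto
    moreover have "eventually (\<lambda>y. twist A y 1 = f y) (at x)"
      using eventually_neq_at_within[of x x UNIV]
    proof eventually_elim
      case (elim y)
      have "moebius_denom A y = of_int (A $ 2 $ 1) * (y - x)"
        using True by (simp add: moebius_denom_def algebra_simps)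
      then show ?case using elim c f[of y] by simp
    qed
    ultimately have "(f \<longlongrightarrow> twist A x 1) (at x)" by (rule Lim_transform_eventually)
    then have "Lim (at x) f = twist A x 1" by (intro tendsto_Lim) auto
    then show ?thesis using True by (simp add: slash_mat_def f_def)
  qed (use f in \<open>simp add: slash_mat_def f_def\<close>)
qed

lemma slash_pgl:
  assumes A: "invertible A"
  shows "slash r P (pgl A) x = twist A x 1"
proof -
  obtain B where "A ** B = mat 1" "B ** A = mat 1" using A by (auto simp: invertible_def)
  then have mA: "invertible (- A)"
    unfolding invertible_def
    by (intro exI[of _ "- B"]) (simp add: matrix_matrix_mult_def vec_eq_iff)
  have "twist (- A) x 1 = twist A x 1" for x
    using twist_scale[of "- 1" A x 1] form_scale[of "-1" "row1 A x 1" "row2 A x 1"]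
    by (simp add: twist_def row1_def row2_def)
  then have "slash_mat r P (- A) = slash_mat r P A"
    using A mA by (simp add: fun_eq_iff slash_mat_eq_twist)
  then show ?thesis using A by (simp add: slash_def pgl_eq slash_mat_eq_twist)
qed

text \<open>By homogeneity \<open>P\<^sup>\<gamma>(x) / x\<^sup>2\<^sup>r\<close> is the twisted form at \<open>(1, 1/x)\<close>, which tends to its value at \<open>(1, 0)\<close>.\<close>

lemma slash_at_inf_pgl:
  assumes A: "invertible A"
  shows "slash_at_inf r P (pgl A) = twist A 1 0"
proof -
  have inv0: "((\<lambda>x::real. 1 / x) \<longlongrightarrow> 0) at_infinity"
    using tendsto_inverse_0[where 'a = real] by (simp add: divide_inverse)
  have "((\<lambda>x. twist A 1 (1 / x)) \<longlongrightarrow> twist A 1 0) at_infinity"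
    by (rule tendsto_twist[OF A tendsto_const inv0]) simp
  moreover have "eventually (\<lambda>x. twist A 1 (1 / x) = slash r P (pgl A) x / x ^ (2 * r)) at_infinity"
  proof (rule eventually_mono[OF eventually_not_equal_at_infinity[of 0]])
    fix x :: real assume "x \<noteq> 0"
    then show "twist A 1 (1 / x) = slash r P (pgl A) x / x ^ (2 * r)"
      using twist_scale[of x A 1 "1 / x"] by (simp add: slash_pgl[OF A])
  qed
  ultimately have "((\<lambda>x. slash r P (pgl A) x / x ^ (2 * r)) \<longlongrightarrow> twist A 1 0) at_infinity"
    by (rule Lim_transform_eventually)
  then show ?thesis unfolding slash_at_inf_def by (intro tendsto_Lim) (auto simp: at_infinity_eq_at_top_bot)
qed

lemma signed_slash_pgl:
  assumes A: "invertible A"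
  shows "signed_slash r P (pgl A) x = - sgn (twist A 1 0) * twist A x 1"
  using twist_rational_nonzero(1)[OF A]
  by (simp add: signed_slash_def slash_sign_def slash_at_inf_pgl[OF A] slash_pgl[OF A])

lemma stab_subset: "stab r P \<subseteq> carrier PGL2Z"
  by (auto simp: stab_def)

text \<open>The normalising sign of \<open>P\<close> itself is \<open>1\<close> because its leading coefficient is negative.\<close>

lemma one_in_stab: "\<one>\<^bsub>PGL2Z\<^esub> \<in> stab r P"
proof -
  have t: "twist (mat 1) x y = form x y" for x y
    by (simp add: twist_def row1_def row2_def mat_def)
  have "signed_slash r P (pgl (mat 1)) = P"
    using L_neg by (simp add: fun_eq_iff signed_slash_pgl invertible_mat_one t form_one form_infinity)
  then show ?thesis by (simp add: stab_def pgl_one pgl_in_PGL2Z invertible_mat_one)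
qed

text \<open>An element of the stabilizer fixes \<open>P\<close> up to a sign \<open>s\<close>, hence it fixes the whole form up to \<open>s\<close>; further
twisting by \<open>A\<close> carries the factor \<open>s\<close> along, and the sign normalisation removes it.\<close>

lemma signed_slash_stab_mult:
  assumes B: "invertible B" "pgl B \<in> stab r P" and A: "invertible A"
  shows "signed_slash r P (pgl (B ** A)) = signed_slash r P (pgl A)"
proof
  fix x
  define s where "s = - sgn (twist B 1 0)"
  have s: "s * s = 1" using twist_rational_nonzero(1)[OF B(1)] by (auto simp: s_def sgn_if)
  have P: "s * twist B x 1 = P x" for x
    using B signed_slash_pgl[OF B(1), of x] by (simp add: stab_def s_def)
  have P': "twist B x 1 = s * form x 1" for x
    using s by (simp add: form_one P[symmetric] mult.assoc[symmetric])
  \<comment> \<open>The relation at infinity is the limit of the one at finite points.\<close>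
  have inf: "twist B 1 0 = s * L"
  proof -
    have "slash r P (pgl B) x / x ^ (2 * r) = s * (P x / x ^ (2 * r))" for x
      by (simp add: slash_pgl[OF B(1)] P' form_one)
    then have "slash_at_inf r P (pgl B) = Lim at_infinity (\<lambda>x. s * (P x / x ^ (2 * r)))"
      unfolding slash_at_inf_def by presburger
    also have "\<dots> = s * L"
      by (intro tendsto_Lim tendsto_intros P_lim) (auto simp: at_infinity_eq_at_top_bot)
    finally show ?thesis by (simp add: slash_at_inf_pgl[OF B(1)])
  qed
  have form: "twist B x y = s * form x y" if "x \<noteq> 0 \<or> y \<noteq> 0" for x y
  proof (cases "y = 0")
    case True
    then show ?thesis using that twist_scale[of x B 1 0] form_scale[of x 1 0] inf form_infinity by simp
  next
    case False
    then show ?thesis using twist_scale[of y B "x / y" 1] form_scale[of y "x / y" 1] P'[of "x / y"] by simp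
  qed
  have BA: "twist (B ** A) x y = s * twist A x y" if "x \<noteq> 0 \<or> y \<noteq> 0" for x y
    using form[OF rows_nonzero[OF A that]] by (simp add: twist_def row_mult)
  have "signed_slash r P (pgl (B ** A)) x = - sgn (twist (B ** A) 1 0) * twist (B ** A) x 1"
    by (rule signed_slash_pgl) (use A B in \<open>auto intro: invertible_mult\<close>)
  also have "\<dots> = - (sgn s * s) * sgn (twist A 1 0) * twist A x 1"
    by (simp add: BA sgn_mult)
  also have "sgn s * s = 1" using s by (auto simp: sgn_if s_def split: if_splits)
  finally show "signed_slash r P (pgl (B ** A)) x = signed_slash r P (pgl A) x"
    by (simp add: signed_slash_pgl[OF A])
qed

text \<open>All elements of a coset give the same signed function, so any representative \<open>A\<close> computes it. This formula
is the only property of \<open>coset_fun\<close> that its transformation laws rest on.\<close>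

lemma coset_fun_pgl:
  assumes A: "invertible A"
  shows "coset_fun r P (stab r P #>\<^bsub>PGL2Z\<^esub> pgl A) x = - sgn (twist A 1 0) * twist A x 1"
proof -
  interpret group PGL2Z by (rule group_PGL2Z)
  have *: "signed_slash r P (h \<otimes>\<^bsub>PGL2Z\<^esub> pgl A) = signed_slash r P (pgl A)" if h: "h \<in> stab r P" for h
  proof -
    obtain B where B: "invertible B" "h = pgl B" using h stab_subset by (blast elim: PGL2Z_cases)
    then show ?thesis using signed_slash_stab_mult[of B A] A h by (simp add: pgl_mult)
  qed
  have "signed_slash r P ` (stab r P #>\<^bsub>PGL2Z\<^esub> pgl A) = {signed_slash r P (pgl A)}"
    using one_in_stab by (auto simp: r_coset_def image_iff *)
  then show ?thesis by (simp add: coset_fun_def signed_slash_pgl[OF A])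
qed

section \<open>Right multiplication on cosets\<close>

lemma stab_coset_cases:
  assumes "C \<in> stab_cosets r P"
  obtains A where "invertible A" "C = stab r P #>\<^bsub>PGL2Z\<^esub> pgl A"
  using assms by (auto simp: stab_cosets_def RCOSETS_def elim: PGL2Z_cases)

lemma stab_coset_mult:
  assumes "invertible A" "invertible S"
  shows "(stab r P #>\<^bsub>PGL2Z\<^esub> pgl A) #>\<^bsub>PGL2Z\<^esub> pgl S = stab r P #>\<^bsub>PGL2Z\<^esub> pgl (A ** S)"
proof -
  interpret group PGL2Z by (rule group_PGL2Z)
  show ?thesis
    using assms by (simp add: coset_mult_assoc stab_subset pgl_in_PGL2Z pgl_mult)
qed

lemma right_mult_inverse:
  assumes C: "C \<in> stab_cosets r P" and g: "g \<in> carrier PGL2Z"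
  shows "C #>\<^bsub>PGL2Z\<^esub> g \<in> stab_cosets r P" and "C #>\<^bsub>PGL2Z\<^esub> g #>\<^bsub>PGL2Z\<^esub> inv\<^bsub>PGL2Z\<^esub> g = C"
proof -
  interpret group PGL2Z by (rule group_PGL2Z)
  obtain h where h: "h \<in> carrier PGL2Z" "C = stab r P #>\<^bsub>PGL2Z\<^esub> h"
    using C by (auto simp: stab_cosets_def RCOSETS_def)
  then have "C #>\<^bsub>PGL2Z\<^esub> g = stab r P #>\<^bsub>PGL2Z\<^esub> (h \<otimes>\<^bsub>PGL2Z\<^esub> g)"
    using g by (simp add: coset_mult_assoc stab_subset)
  then show "C #>\<^bsub>PGL2Z\<^esub> g \<in> stab_cosets r P"
    using h g by (auto simp: stab_cosets_def RCOSETS_def)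
  show "C #>\<^bsub>PGL2Z\<^esub> g #>\<^bsub>PGL2Z\<^esub> inv\<^bsub>PGL2Z\<^esub> g = C"
    using h g by (simp add: coset_mult_assoc stab_subset m_assoc)
qed

lemma right_mult_bij:
  assumes g: "g \<in> carrier PGL2Z"
  shows "bij_betw (\<lambda>C. C #>\<^bsub>PGL2Z\<^esub> g) (stab_cosets r P) (stab_cosets r P)"
proof -
  interpret group PGL2Z by (rule group_PGL2Z)
  show ?thesis
    by (rule bij_betwI[where g = "\<lambda>C. C #>\<^bsub>PGL2Z\<^esub> inv\<^bsub>PGL2Z\<^esub> g"])
      (use g right_mult_inverse right_mult_inverse[of _ "inv\<^bsub>PGL2Z\<^esub> g"] in auto)
qed

lemma coset_fun_continuous:
  assumes "C \<in> stab_cosets r P"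
  shows "continuous_on UNIV (coset_fun r P C)"
proof -
  obtain A where A: "invertible A" "C = stab r P #>\<^bsub>PGL2Z\<^esub> pgl A"
    using assms by (rule stab_coset_cases)
  have "((\<lambda>x. twist A x 1) \<longlongrightarrow> twist A x 1) (at x)" for x
    by (rule tendsto_twist[OF A(1)]) auto
  then have "continuous_on UNIV (\<lambda>x. - sgn (twist A 1 0) * twist A x 1)"
    by (intro continuous_intros) (simp add: continuous_on_def)
  then show ?thesis using A by (simp add: coset_fun_pgl)
qed

text \<open>The representative \<open>A ** S\<close> of the new coset twists by \<open>S\<close> first and by \<open>A\<close> afterwards. The sign is
evaluated at the first column of \<open>S\<close>, the image of infinity.\<close>

lemma coset_fun_mult:
  assumes "invertible A" "invertible S" "C = stab r P #>\<^bsub>PGL2Z\<^esub> pgl A"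
  shows "coset_fun r P (C #>\<^bsub>PGL2Z\<^esub> pgl S) x =
    - sgn (twist A (of_int (S $ 1 $ 1)) (of_int (S $ 2 $ 1))) *
      twist A (of_int (S $ 1 $ 1) * x + of_int (S $ 1 $ 2)) (of_int (S $ 2 $ 1) * x + of_int (S $ 2 $ 2))"
  using assms invertible_mult[OF assms(1,2)]
  by (simp add: stab_coset_mult coset_fun_pgl twist_def row_mult) (simp add: row1_def row2_def)

lemma coset_fun_translate:
  assumes "C \<in> stab_cosets r P"
  shows "coset_fun r P (C #>\<^bsub>PGL2Z\<^esub> pgl mat_T) x = coset_fun r P C (x + 1)"
proof -
  obtain A where A: "invertible A" "C = stab r P #>\<^bsub>PGL2Z\<^esub> pgl A"
    using assms by (rule stab_coset_cases)
  then show ?thesis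
    by (simp add: coset_fun_mult[OF _ invertible_generators(1) refl] coset_fun_pgl mat_entries)
qed

lemma coset_fun_reflect:
  assumes "C \<in> stab_cosets r P"
  shows "coset_fun r P (C #>\<^bsub>PGL2Z\<^esub> pgl mat_V) x = coset_fun r P C (- x)"
proof -
  obtain A where A: "invertible A" "C = stab r P #>\<^bsub>PGL2Z\<^esub> pgl A"
    using assms by (rule stab_coset_cases)
  have "twist A (- 1) 0 = twist A 1 0" using twist_scale[of "- 1" A 1 0] by simp
  then show ?thesis
    using A by (simp add: coset_fun_mult[OF _ invertible_generators(2) refl] coset_fun_pgl mat_entries)
qed

text \<open>The matrix \<open>mat_U\<close> exchanges the points \<open>(1, 0)\<close> and \<open>(0, 1)\<close>. The value at \<open>0\<close> is \<open>- sgn F(1, 0) F(0, 1)\<close> for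
\<open>C\<close> and \<open>- sgn F(0, 1) F(1, 0)\<close> for its image, where \<open>F\<close> is the form twisted by a
representative: the two have the same sign. The ratio of the two normalising signs is
\<open>sgn F(1, 0) sgn F(0, 1)\<close>, which is \<open>-1\<close> exactly when this value is positive.\<close>

lemma coset_fun_invert:
  assumes "C \<in> stab_cosets r P"
  shows "coset_fun r P (C #>\<^bsub>PGL2Z\<^esub> pgl mat_U) 0 > 0 \<longleftrightarrow> coset_fun r P C 0 > 0"
    and "x \<noteq> 0 \<Longrightarrow> coset_fun r P (C #>\<^bsub>PGL2Z\<^esub> pgl mat_U) x =
      (if coset_fun r P C 0 > 0 then - 1 else 1) * (x ^ (2 * r) * coset_fun r P C (1 / x))"
proof -
  obtain A where A: "invertible A" "C = stab r P #>\<^bsub>PGL2Z\<^esub> pgl A"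
    using assms by (rule stab_coset_cases)
  have U: "coset_fun r P (C #>\<^bsub>PGL2Z\<^esub> pgl mat_U) x = - sgn (twist A 0 1) * twist A 1 x" for x
    using A by (simp add: coset_fun_mult[OF _ invertible_generators(3) refl] mat_entries)
  have C: "coset_fun r P C x = - sgn (twist A 1 0) * twist A x 1" for x
    using A by (simp add: coset_fun_pgl)
  show "coset_fun r P (C #>\<^bsub>PGL2Z\<^esub> pgl mat_U) 0 > 0 \<longleftrightarrow> coset_fun r P C 0 > 0"
    by (auto simp: U C sgn_if split: if_splits)
  assume x: "x \<noteq> 0"
  have "twist A 1 x = x ^ (2 * r) * twist A (1 / x) 1" using twist_scale[of x A "1 / x" 1] x by simp
  then show "coset_fun r P (C #>\<^bsub>PGL2Z\<^esub> pgl mat_U) x =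
      (if coset_fun r P C 0 > 0 then - 1 else 1) * (x ^ (2 * r) * coset_fun r P C (1 / x))"
    using twist_rational_nonzero[OF A(1)] by (auto simp: U C sgn_if split: if_splits)
qed

end

section \<open>The series of positive parts\<close>

theorem theorem2:
  fixes r :: nat
    and P :: "real \<Rightarrow> real"
    and lam :: "(int^2^2) set set \<Rightarrow> real \<Rightarrow> real"
  assumes "r \<ge> 1"
    and A1: "continuous_on UNIV P" "piecewise_poly (2 * r) P"
    and A2: "\<exists>\<alpha> \<beta>. \<alpha> < \<beta> \<and> \<alpha> \<notin> \<rat> \<and> \<beta> \<notin> \<rat> \<and> {x. P x = 0} = {\<alpha>, \<beta>} \<and>
               (\<forall>x\<in>{\<alpha><..<\<beta>}. P x > 0) \<and> (\<forall>x. x \<notin> {\<alpha>..\<beta>} \<longrightarrow> P x < 0)"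
    and A3: "\<exists>L<0. ((\<lambda>x. P x / x ^ (2 * r)) \<longlongrightarrow> L) at_bot \<and>
                   ((\<lambda>x. P x / x ^ (2 * r)) \<longlongrightarrow> L) at_top"
    and nonneg: "\<And>C x. C \<in> stab_cosets r P \<Longrightarrow> lam C x \<ge> 0"
    and C': "\<And>\<sigma> C x. \<sigma> \<in> {mat_T, mat_V, mat_U} \<Longrightarrow> C \<in> stab_cosets r P \<Longrightarrow>
               moebius_denom \<sigma> x \<noteq> 0 \<Longrightarrow>
               lam (C #>\<^bsub>PGL2Z\<^esub> inv\<^bsub>PGL2Z\<^esub> (pgl \<sigma>)) (moebius_act \<sigma> x) = lam C x"
    and P1': "\<And>C. C \<in> stab_cosets r P \<Longrightarrow>
               continuous_on UNIV (\<lambda>x. lam C x * coset_fun r P C x)"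
    and P3': "finite {C \<in> stab_cosets r P. coset_fun r P C 0 > 0}"
  shows "(\<forall>x. T_term r P lam x summable_on stab_cosets r P) \<and>
         (\<forall>x. T_sum r P lam (- x) = T_sum r P lam x) \<and>
         (\<forall>x. T_sum r P lam (x + 1) = T_sum r P lam x) \<and>
         continuous_on UNIV (T_sum r P lam) \<and>
         (\<forall>x. x \<noteq> 0 \<longrightarrow>
            x ^ (2 * r) * T_sum r P lam (1 / x) - T_sum r P lam x = - R_sum r P lam x)"
proof -
  obtain L where L: "L < 0" "((\<lambda>x. P x / x ^ (2 * r)) \<longlongrightarrow> L) at_bot"
      "((\<lambda>x. P x / x ^ (2 * r)) \<longlongrightarrow> L) at_top"
    using A3 by blast
  interpret binary_form r P L
  proof
    show "((\<lambda>x. P x / x ^ (2 * r)) \<longlongrightarrow> L) at_infinity"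
      unfolding at_infinity_eq_at_top_bot using L by (intro filterlim_sup)
    show "P x \<noteq> 0" if x: "x \<in> \<rat>" for x
    proof -
      obtain \<alpha> \<beta> where "\<alpha> \<notin> \<rat>" "\<beta> \<notin> \<rat>" and roots: "{x. P x = 0} = {\<alpha>, \<beta>}"
        using A2 by blast
      then have "x \<notin> {x. P x = 0}" unfolding roots using x by blast
      then show ?thesis by simp
    qed
  qed (use A1 L in auto)
  have generator: "pgl \<sigma> \<in> carrier PGL2Z" if "\<sigma> \<in> {mat_T, mat_V, mat_U}" for \<sigma>
    using that invertible_generators by (auto intro: pgl_in_PGL2Z)
  \<comment> \<open>The compatibility of the weights, applied to \<open>C\<sigma>\<close> in place of \<open>C\<close> to eliminate the inverse.\<close>
  have lam_mult: "lam (C #>\<^bsub>PGL2Z\<^esub> pgl \<sigma>) x = lam C (moebius_act \<sigma> x)"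
    if "\<sigma> \<in> {mat_T, mat_V, mat_U}" "C \<in> stab_cosets r P" "moebius_denom \<sigma> x \<noteq> 0" for \<sigma> C x
    using C'[OF that(1) right_mult_inverse(1)[OF that(2) generator[OF that(1)]] that(3)]
    by (simp add: right_mult_inverse(2)[OF that(2) generator[OF that(1)]])
  interpret system: reciprocal_system r "stab_cosets r P" "coset_fun r P" lam
    "\<lambda>C. C #>\<^bsub>PGL2Z\<^esub> pgl mat_T" "\<lambda>C. C #>\<^bsub>PGL2Z\<^esub> pgl mat_U"
  proof
    show "bij_betw (\<lambda>C. C #>\<^bsub>PGL2Z\<^esub> pgl mat_T) (stab_cosets r P) (stab_cosets r P)"
      by (rule right_mult_bij[OF generator]) simp
    show "bij_betw (\<lambda>C. C #>\<^bsub>PGL2Z\<^esub> pgl mat_U) (stab_cosets r P) (stab_cosets r P)"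
      by (rule right_mult_bij[OF generator]) simp
    show "lam (C #>\<^bsub>PGL2Z\<^esub> pgl mat_T) x = lam C (x + 1)" if "C \<in> stab_cosets r P" for C x
      using lam_mult[of mat_T C x] that by (simp add: moebius_denom_def moebius_act_def mat_entries)
    show "lam (C #>\<^bsub>PGL2Z\<^esub> pgl mat_U) x = lam C (1 / x)" if "C \<in> stab_cosets r P" "x \<noteq> 0" for C x
      using lam_mult[of mat_U C x] that by (simp add: moebius_denom_def moebius_act_def mat_entries)
  qed (use \<open>r \<ge> 1\<close> nonneg P1' P3' coset_fun_translate coset_fun_invert coset_fun_continuous in auto)
  have summand: "T_term r P lam x = system.summand x" for x
    by (simp add: fun_eq_iff T_term_def system.summand_def)
  have T: "T_sum r P lam = system.series"
    by (simp add: fun_eq_iff T_sum_def system.series_def summand)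
  have R: "R_sum r P lam = system.defect"
    by (simp add: fun_eq_iff R_sum_def system.defect_def system.positive_at_zero_def)
  have even: "T_sum r P lam (- x) = T_sum r P lam x" for x
  proof -
    have "T_sum r P lam x = (\<Sum>\<^sub>\<infinity>C\<in>stab_cosets r P. T_term r P lam x (C #>\<^bsub>PGL2Z\<^esub> pgl mat_V))"
      unfolding T_sum_def
      by (rule infsum_reindex_bij_betw[OF right_mult_bij[OF generator], symmetric]) simp
    also have "\<dots> = T_sum r P lam (- x)"
      unfolding T_sum_def
    proof (rule infsum_cong)
      fix C assume C: "C \<in> stab_cosets r P"
      show "T_term r P lam x (C #>\<^bsub>PGL2Z\<^esub> pgl mat_V) = T_term r P lam (- x) C"
        using lam_mult[of mat_V C x] C coset_fun_reflect[OF C]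
        by (simp add: T_term_def moebius_denom_def moebius_act_def mat_entries)
    qed
    finally show ?thesis by simp
  qed
  show ?thesis
    using even by (simp add: T R summand system.summable system.series_periodic
        system.series_continuous system.series_reciprocal)
qed

end
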